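(* Let $n\ge 2$ and $B=(a,n-a)$ with $1\le a\le n-1$ ($a$ an integer). Then $$f_B(x,y)=f_B(n-y,\,n-x)\quad\text{for every }(x,y)\in\mathcal{G}(n)\setminus\{(0,0),(n,n)\}.$$ In particular, $f_B(1,1)=f_B(n-1,n-1)$, $f_B(1,0)=f_B(n,n-1)$, and $f_B(0,1)=f_B(n-1,n)$. Moreover, $f_B(0,1)<f_B(1,0)$ if $2a<n$, and $f_B(1,0)<f_B(0,1)$ if $2a>n$.
   Context: For $n\in\mathbb{N}$, $\mathcal{G}(n)=\{(x,y)\in\mathbb{Z}^2: 0\le x\le n,\ 0\le y\le n\}$, and $\mathcal{P}_n$ is the set of lattice paths from $(0,0)$ to $(n,n)$ using only unit east steps $(1,0)$ and unit north steps $(0,1)$. For $A,B\in\mathcal{G}(n)$ with $B\notin\{(0,0),(n,n)\}$, $f_B(A)$ denotes the number of paths $p\in\mathcal{P}_n$ that pass through $A$ and do not pass through $B$ (so $f_B(B)=0$); for $A=(x,y)$ one writes $f_B(x,y)$. *)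

theory Defs imports Main
begin

definition grid :: "nat \<Rightarrow> (int \<times> int) set" where
  "grid n = {(x, y). 0 \<le> x \<and> x \<le> int n \<and> 0 \<le> y \<and> y \<le> int n}"

definition unit_step :: "int \<times> int \<Rightarrow> int \<times> int \<Rightarrow> bool" where
  "unit_step P Q \<longleftrightarrow> Q = (fst P + 1, snd P) \<or> Q = (fst P, snd P + 1)"

text \<open>A path is represented by the list of lattice points it visits, in order, endpoints included.\<close>

definition lattice_paths :: "nat \<Rightarrow> (int \<times> int) list set" where
  "lattice_paths n =
     {p. p \<noteq> [] \<and> hd p = (0, 0) \<and> last p = (int n, int n) \<and> successively unit_step p}"

definition f_avoid :: "nat \<Rightarrow> int \<times> int \<Rightarrow> int \<times> int \<Rightarrow> nat" where
  "f_avoid n B A = card {p \<in> lattice_paths n. A \<in> set p \<and> B \<notin> set p}"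

text \<open>Since \<^const>\<open>card\<close> is 0 on infinite sets, \<^const>\<open>f_avoid\<close> counts paths only because there are
  finitely many of them.\<close>

lemma unit_step_path_length:
  "successively unit_step p \<Longrightarrow> p \<noteq> [] \<Longrightarrow>
    fst (last p) + snd (last p) + 1 = fst (hd p) + snd (hd p) + int (length p)"
  by (induction p rule: induct_list012) (auto simp: unit_step_def)

lemma unit_step_path_bounds:
  "successively unit_step p \<Longrightarrow> P \<in> set p \<Longrightarrow>
    fst (hd p) \<le> fst P \<and> fst P \<le> fst (last p) \<and>
    snd (hd p) \<le> snd P \<and> snd P \<le> snd (last p)"
proof (induction p arbitrary: P rule: induct_list012)
  case (3 Q R p)
  have QR: "fst Q \<le> fst R" "snd Q \<le> snd R" and p: "successively unit_step (R # p)"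
    using "3.prems"(1) by (auto simp: unit_step_def)
  note R = "3.IH"(2)[OF p, of R]
  show ?case
  proof (cases "P = Q")
    case True
    then show ?thesis using QR R by simp
  next
    case False
    then have "P \<in> set (R # p)" using "3.prems"(2) by simp
    then show ?thesis using "3.IH"(2)[OF p, of P] QR by simp
  qed
qed simp_all

lemma finite_lattice_paths: "finite (lattice_paths n)"
proof (rule finite_subset)
  show "lattice_paths n \<subseteq> {p. set p \<subseteq> {0..int n} \<times> {0..int n} \<and> length p = 2 * n + 1}"
  proof
    fix p assume p: "p \<in> lattice_paths n"
    then have s: "successively unit_step p" "p \<noteq> []" "hd p = (0, 0)" "last p = (int n, int n)"
      by (simp_all add: lattice_paths_def)
    have "length p = 2 * n + 1"
      using unit_step_path_length[OF s(1,2)] s(3,4) by simp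
    moreover have "set p \<subseteq> {0..int n} \<times> {0..int n}"
    proof
      fix P assume "P \<in> set p"
      then show "P \<in> {0..int n} \<times> {0..int n}"
        using unit_step_path_bounds[OF s(1), of P] s(3,4) by (simp add: mem_Times_iff)
    qed
    ultimately show "p \<in> {p. set p \<subseteq> {0..int n} \<times> {0..int n} \<and> length p = 2 * n + 1}"
      by simp
  qed
  show "finite {p. set p \<subseteq> {0..int n} \<times> {0..int n} \<and> length p = 2 * n + 1}"
    by (rule finite_lists_length_eq) simp
qed

end

theory Submission imports Defs
begin

text \<open>Both claims come from reflections of the square. The reflection in the antidiagonal, combined
  with a reversal of direction, sends lattice paths to lattice paths. It fixes every point of the
  antidiagonal, \<open>B\<close> among them, and moves \<open>(x, y)\<close> to \<open>(n - y, n - x)\<close>; this gives all the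
  equalities.

  For the inequality, suppose that \<open>2 * a < n\<close>, so that \<open>B\<close> lies strictly above the main diagonal.
  Given a path that starts with a north step, reflect in the main diagonal only its first excursion,
  up to the first return to the diagonal. The new path starts with an east step, and it still avoids
  \<open>B\<close>: the reflected part lies on or below the diagonal, while the remainder is unchanged. So this
  involution injects the paths through \<open>(0, 1)\<close> that avoid \<open>B\<close> into those through \<open>(1, 0)\<close> that
  avoid \<open>B\<close>. It misses every path that visits the mirror image of \<open>B\<close> before its
  first return to the diagonal, since the involution sends such a path to one through \<open>B\<close>; and some
  path of this kind avoids \<open>B\<close>. The case
  \<open>2 * a > n\<close> follows by reflecting entire paths in the main diagonal.\<close>

section \<open>Symmetries of the set of lattice paths\<close>

lemma f_avoid_symmetry:
  assumes inv: "\<And>P. s (s P) = P" and TT: "\<And>p. T (T p) = p"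
    and path: "\<And>p. p \<in> lattice_paths n \<Longrightarrow> T p \<in> lattice_paths n"
    and set: "\<And>p. set (T p) = s ` set p"
  shows "f_avoid n (s B) (s A) = f_avoid n B A"
proof -
  have mem: "s P \<in> s ` X \<longleftrightarrow> P \<in> X" "P \<in> s ` X \<longleftrightarrow> s P \<in> X" for P X
    by (metis image_iff inv)+
  have "bij_betw T {p \<in> lattice_paths n. A \<in> set p \<and> B \<notin> set p}
          {p \<in> lattice_paths n. s A \<in> set p \<and> s B \<notin> set p}"
    by (rule bij_betw_byWitness[where f' = T]) (auto simp: TT set mem inv intro: path)
  then show ?thesis
    unfolding f_avoid_def by (simp add: bij_betw_same_card)
qed

text \<open>The reflection in the antidiagonal turns east steps into south steps and north steps into west
  steps; the reversal makes them north and east steps again and restores the two endpoints.\<close>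

lemma f_avoid_antidiagonal_reflection:
  "f_avoid n (int n - snd B, int n - fst B) (int n - snd A, int n - fst A) = f_avoid n B A"
proof -
  define s where "s P = (int n - snd P, int n - fst P)" for P
  have ss: "s (s P) = P" for P by (simp add: s_def)
  have step: "unit_step (s Q) (s P)" if "unit_step P Q" for P Q
    using that by (auto simp: unit_step_def s_def)
  have "f_avoid n (s B) (s A) = f_avoid n B A"
  proof (rule f_avoid_symmetry[where T = "\<lambda>p. map s (rev p)"])
    fix p assume p: "p \<in> lattice_paths n"
    then have "successively unit_step (map s (rev p))"
      by (auto simp: lattice_paths_def successively_map
          intro: successively_mono[OF _ step])
    then show "map s (rev p) \<in> lattice_paths n"
      using p by (auto simp: lattice_paths_def hd_map last_map hd_rev last_rev s_def)
  qed (simp_all add: ss rev_map o_def)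
  then show ?thesis by (simp add: s_def)
qed

lemma f_avoid_transpose: "f_avoid n (prod.swap B) (prod.swap A) = f_avoid n B A"
proof (rule f_avoid_symmetry[where T = "map prod.swap"])
  have step: "unit_step (prod.swap P) (prod.swap Q)" if "unit_step P Q" for P Q
    using that by (auto simp: unit_step_def)
  fix p assume p: "p \<in> lattice_paths n"
  then have "successively unit_step (map prod.swap p)"
    by (auto simp: lattice_paths_def successively_map intro: successively_mono[OF _ step])
  then show "map prod.swap p \<in> lattice_paths n"
    using p by (auto simp: lattice_paths_def hd_map last_map)
qed simp_all

section \<open>Reflecting the first excursion from the diagonal\<close>

fun swap_until_diagonal :: "(int \<times> int) list \<Rightarrow> (int \<times> int) list" where
  "swap_until_diagonal [] = []"
| "swap_until_diagonal (P # p) =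
     (if fst P = snd P then P # p else prod.swap P # swap_until_diagonal p)"

text \<open>A lattice path begins on the diagonal, so its first point is set aside before the first
  return to the diagonal is sought.\<close>

definition swap_first_excursion :: "(int \<times> int) list \<Rightarrow> (int \<times> int) list" where
  "swap_first_excursion p = hd p # swap_until_diagonal (tl p)"

lemma swap_until_diagonal_involution: "swap_until_diagonal (swap_until_diagonal p) = p"
  by (induction p) auto

lemma swap_until_diagonal_eq_Nil [simp]: "swap_until_diagonal p = [] \<longleftrightarrow> p = []"
  by (cases p) auto

lemma hd_swap_until_diagonal: "p \<noteq> [] \<Longrightarrow> hd (swap_until_diagonal p) = prod.swap (hd p)"
  by (cases p) (auto simp: prod_eq_iff)

lemma last_swap_until_diagonal:
  "p \<noteq> [] \<Longrightarrow> fst (last p) = snd (last p) \<Longrightarrow> last (swap_until_diagonal p) = last p"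
  by (induction p) (auto simp: prod_eq_iff)

text \<open>The reflected part and the untouched part fit together, because the junction lies on the
  diagonal and is therefore its own mirror image.\<close>

lemma successively_swap_until_diagonal:
  "successively unit_step p \<Longrightarrow> successively unit_step (swap_until_diagonal p)"
  by (induction p) (auto simp: successively_Cons hd_swap_until_diagonal unit_step_def)

lemma lattice_path_Cons:
  assumes "n > 0" "p \<in> lattice_paths n"
  obtains q where "p = (0, 0) # q" "q \<noteq> []" "last q = (int n, int n)"
    "successively unit_step q" "hd q = (1, 0) \<or> hd q = (0, 1)"
  using assms by (cases p) (auto simp: lattice_paths_def successively_Cons unit_step_def split: if_splits)

lemma swap_first_excursion_involution:
  "p \<noteq> [] \<Longrightarrow> swap_first_excursion (swap_first_excursion p) = p"
  by (simp add: swap_first_excursion_def swap_until_diagonal_involution)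

lemma swap_first_excursion_lattice_path:
  assumes "n > 0" "p \<in> lattice_paths n"
  shows "swap_first_excursion p \<in> lattice_paths n"
  using assms(1,2)
  by (rule lattice_path_Cons)
    (auto simp: swap_first_excursion_def lattice_paths_def successively_Cons
      hd_swap_until_diagonal last_swap_until_diagonal successively_swap_until_diagonal unit_step_def[of "(0, 0)"])

text \<open>The coordinate sum increases along a path, so a path can visit only one of \<open>(1, 0)\<close> and
  \<open>(0, 1)\<close>, and only right after the origin.\<close>

lemma passes_first_step_iff:
  assumes "n > 0" "p \<in> lattice_paths n" "A = (1, 0) \<or> A = (0, 1)"
  shows "A \<in> set p \<longleftrightarrow> hd (tl p) = A"
proof -
  obtain q where q: "p = (0, 0) # q" "q \<noteq> []"
    "successively unit_step q" "hd q = (1, 0) \<or> hd q = (0, 1)"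
    using assms(1,2) by (rule lattice_path_Cons)
  have "A \<in> set q \<Longrightarrow> A = hd q"
    using unit_step_path_bounds[OF q(3), of A] q(4) assms(3) by auto
  moreover have "hd q \<in> set q" using q(2) by simp
  ultimately show ?thesis using q(1,4) assms(3) by auto
qed

text \<open>While the path stays above the diagonal its reflection stays below, so a point above the
  diagonal can only be met in the part that is left unchanged.\<close>

lemma above_diagonal_mem_swap_until_diagonal:
  assumes "successively unit_step p" "p \<noteq> [] \<Longrightarrow> fst (hd p) \<le> snd (hd p)"
    and "fst C < snd C" "C \<in> set (swap_until_diagonal p)"
  shows "C \<in> set p"
  using assms
proof (induction p)
  case (Cons P p)
  show ?case
  proof (cases "fst P = snd P")
    case False
    then have "fst P < snd P" using Cons.prems(2) by simp
    moreover have "C \<noteq> prod.swap P" using \<open>fst P < snd P\<close> Cons.prems(3) by auto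
    ultimately show ?thesis
      using Cons False by (auto simp: successively_Cons unit_step_def)
  qed (use Cons.prems in simp)
qed simp

text \<open>The coordinate sum orders the points of a path by time of visit, so the last hypothesis says
  that \<open>P\<close> is visited before the diagonal is met and hence belongs to the reflected part.\<close>

lemma swap_mem_swap_until_diagonal:
  assumes "successively unit_step p" "P \<in> set p"
    and "\<And>R. R \<in> set p \<Longrightarrow> fst R + snd R \<le> fst P + snd P \<Longrightarrow> fst R \<noteq> snd R"
  shows "prod.swap P \<in> set (swap_until_diagonal p)"
  using assms
proof (induction p)
  case (Cons Q p)
  have "fst Q \<le> fst P \<and> snd Q \<le> snd P"
    using unit_step_path_bounds[OF Cons.prems(1,2)] by simp
  then have "fst Q \<noteq> snd Q"
    using Cons.prems(3)[of Q] by simp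
  then show ?case using Cons by (auto simp: successively_Cons)
qed simp

section \<open>The comparison of the two first steps\<close>

text \<open>A path below the diagonal through the mirror image \<open>(c, b)\<close> of a point \<open>(b, c)\<close>: \<open>c\<close> steps
  east, \<open>m\<close> steps north, and the remaining steps east. Its first return to the
  diagonal is at \<open>(c, c)\<close>, after \<open>(c, b)\<close>.\<close>

lemma path_below_diagonal_exists:
  fixes b c :: int
  assumes "0 \<le> b" "b < c" "c \<le> int m"
  obtains q where "q \<in> lattice_paths m" "(1, 0) \<in> set q" "(c, b) \<in> set q" "(b, c) \<notin> set q"
    "\<And>R. R \<in> set q \<Longrightarrow> R \<noteq> (0, 0) \<Longrightarrow> fst R + snd R \<le> b + c \<Longrightarrow> fst R \<noteq> snd R"
proof -
  define g where "g t = (if int t \<le> c then (int t, 0)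
    else if int t \<le> c + int m then (c, int t - c) else (int t - int m, int m))" for t
  define q where "q = map g [0..<Suc (2 * m)]"
  have g_mem: "g t \<in> set q" if "t \<le> 2 * m" for t
    using that by (simp add: q_def del: upt_Suc)
  have "successively unit_step q"
    unfolding q_def successively_conv_nth by (auto simp: g_def unit_step_def simp del: upt_Suc)
  moreover have "hd q = (0, 0)" "last q = (int m, int m)" "q \<noteq> []"
    using assms by (auto simp: q_def g_def hd_map last_map simp del: upt_Suc)
  ultimately have "q \<in> lattice_paths m" by (simp add: lattice_paths_def)
  moreover have "(1, 0) \<in> set q"
  proof -
    have "g 1 = (1, 0)" using assms by (simp add: g_def)
    moreover have "1 \<le> 2 * m" using assms by linarith
    ultimately show ?thesis using g_mem by metis
  qed
  moreover have "(c, b) \<in> set q"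
  proof -
    have "g (nat (b + c)) = (c, b)" using assms by (auto simp: g_def)
    moreover have "nat (b + c) \<le> 2 * m" using assms by linarith
    ultimately show ?thesis using g_mem by metis
  qed
  moreover have "(b, c) \<notin> set q"
    using assms by (auto simp: q_def g_def simp del: upt_Suc split: if_splits)
  moreover have "fst R \<noteq> snd R" if "R \<in> set q" "R \<noteq> (0, 0)" "fst R + snd R \<le> b + c" for R
    using that assms by (auto simp: q_def g_def simp del: upt_Suc split: if_splits)
  ultimately show ?thesis using that by blast
qed

lemma f_avoid_first_step_less:
  assumes B: "0 \<le> b" "b < c" "c \<le> int n"
  shows "f_avoid n (b, c) (0, 1) < f_avoid n (b, c) (1, 0)"
proof -
  let ?T = swap_first_excursion
  define N where "N = {p \<in> lattice_paths n. (0, 1) \<in> set p \<and> (b, c) \<notin> set p}"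
  define E where "E = {p \<in> lattice_paths n. (1, 0) \<in> set p \<and> (b, c) \<notin> set p}"
  have n: "n > 0" using B by simp
  have ne: "p \<noteq> []" if "p \<in> lattice_paths n" for p
    using that by (simp add: lattice_paths_def)
  have T_N: "?T p \<in> E" if "p \<in> N" for p
  proof -
    have p: "p \<in> lattice_paths n" "(0, 1) \<in> set p" "(b, c) \<notin> set p"
      using that by (simp_all add: N_def)
    obtain q where q: "p = (0, 0) # q" "q \<noteq> []" "successively unit_step q"
      using n p(1) by (rule lattice_path_Cons)
    have "hd q = (0, 1)" using passes_first_step_iff[OF n p(1), of "(0, 1)"] p(2) q(1) by simp
    moreover from this have "(b, c) \<notin> set (swap_until_diagonal q)"
      using above_diagonal_mem_swap_until_diagonal[OF q(3), of "(b, c)"] B p(3) q(1) by auto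
    moreover have "hd (swap_until_diagonal q) \<in> set (swap_until_diagonal q)"
      using q(2) by (intro hd_in_set) simp
    ultimately show ?thesis
      using swap_first_excursion_lattice_path[OF n p(1)] q B
      by (auto simp: E_def swap_first_excursion_def hd_swap_until_diagonal)
  qed
  obtain q where q: "q \<in> lattice_paths n" "(1, 0) \<in> set q" "(c, b) \<in> set q" "(b, c) \<notin> set q"
    and off: "\<And>R. R \<in> set q \<Longrightarrow> R \<noteq> (0, 0) \<Longrightarrow> fst R + snd R \<le> b + c \<Longrightarrow> fst R \<noteq> snd R"
    using path_below_diagonal_exists[OF B] by metis
  have "q \<in> E" using q by (simp add: E_def)
  moreover have "q \<notin> ?T ` N"
  proof
    assume "q \<in> ?T ` N"
    then obtain p where p: "p \<in> N" "q = ?T p" by blast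
    then have "p = ?T q"
      using ne by (simp add: N_def swap_first_excursion_involution)
    obtain r where r: "q = (0, 0) # r" "successively unit_step r" "hd r = (1, 0) \<or> hd r = (0, 1)"
      using n q(1) by (rule lattice_path_Cons)
    have "(0, 0) \<notin> set r"
      using unit_step_path_bounds[OF r(2), of "(0, 0)"] r(3) by auto
    then have "prod.swap (c, b) \<in> set (swap_until_diagonal r)"
      using r(1) q(3) B by (intro swap_mem_swap_until_diagonal[OF r(2)] off) auto
    then have "(b, c) \<in> set p"
      using \<open>p = ?T q\<close> r(1) by (simp add: swap_first_excursion_def)
    then show False using p(1) by (simp add: N_def)
  qed
  ultimately have "?T ` N \<subset> E" using T_N by blast
  moreover have "finite E" using finite_lattice_paths by (simp add: E_def)
  ultimately have "card (?T ` N) < card E" by (rule psubset_card_mono[rotated])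
  moreover have "inj_on ?T N"
    by (rule inj_on_inverseI[where g = ?T]) (simp add: N_def ne swap_first_excursion_involution)
  ultimately show ?thesis by (simp add: card_image f_avoid_def N_def E_def)
qed

theorem proposition7p1:
  fixes n :: nat and a :: int and B :: "int \<times> int"
  assumes "2 \<le> n" and "1 \<le> a" and "a \<le> int n - 1" and "B = (a, int n - a)"
  shows "(\<forall>(x, y) \<in> grid n - {(0, 0), (int n, int n)}.
            f_avoid n B (x, y) = f_avoid n B (int n - y, int n - x))
    \<and> f_avoid n B (1, 1) = f_avoid n B (int n - 1, int n - 1)
    \<and> f_avoid n B (1, 0) = f_avoid n B (int n, int n - 1)
    \<and> f_avoid n B (0, 1) = f_avoid n B (int n - 1, int n)
    \<and> (2 * a < int n \<longrightarrow> f_avoid n B (0, 1) < f_avoid n B (1, 0))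
    \<and> (2 * a > int n \<longrightarrow> f_avoid n B (1, 0) < f_avoid n B (0, 1))"
proof -
  have sym: "f_avoid n B (x, y) = f_avoid n B (int n - y, int n - x)" for x y
    using f_avoid_antidiagonal_reflection[of n B "(x, y)"] assms(4) by simp
  have "f_avoid n B (0, 1) < f_avoid n B (1, 0)" if "2 * a < int n"
    using f_avoid_first_step_less[of a "int n - a" n] that assms by simp
  moreover have "f_avoid n B (1, 0) < f_avoid n B (0, 1)" if "2 * a > int n"
    using f_avoid_first_step_less[of "int n - a" a n] that assms
      f_avoid_transpose[of n B "(1, 0)"] f_avoid_transpose[of n B "(0, 1)"] by simp
  ultimately show ?thesis
    using sym[of 1 1] sym[of 1 0] sym[of 0 1] sym by auto
qed

end
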